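(* Let $a,b$ be positive integers, let $\mathbb{E}^a$ and $\mathbb{E}^b$ be the Euclidean spaces of dimensions $a$ and $b$, and let $p$ be a positive even integer. Then $$e(\mathbb{E}^a\oplus_p\mathbb{E}^b)\le \binom{a+p/2}{a}+\binom{b+p/2}{b}.$$
   Context: $\mathbb{E}^n$ denotes $\mathbb{R}^n$ with the standard Euclidean norm $\|\cdot\|$. For real $p\ge 1$, the space $\mathbb{E}^{a}\oplus_p\mathbb{E}^{b}$ is the product $\mathbb{E}^a\times\mathbb{E}^b$ equipped with the norm $\|(x_1,x_2)\|_p=\left(\|x_1\|^p+\|x_2\|^p\right)^{1/p}$ for $x_1\in\mathbb{E}^a$, $x_2\in\mathbb{E}^b$, and distance $\|x-y\|_p$. A subset $S$ of a normed space is an equilateral set if the distances between distinct points of $S$ take only one value. $e(X)$ denotes the maximum cardinality of an equilateral set in $X$; thus $e(X)\le N$ means that every equilateral set in $X$ has at most $N$ points. *)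

theory Defs
  imports "HOL-Analysis.Analysis" "HOL-Library.Extended_Nat"
begin

text \<open>
  The norm of the \<open>p\<close>-sum of two normed spaces. It is a separate function because the library
  instance of \<open>norm\<close> on a product type is the case \<open>p = 2\<close>. Recall \<open>0 powr p = 0\<close>.
\<close>

definition psum_norm ::
    "real \<Rightarrow> 'x::real_normed_vector \<times> 'y::real_normed_vector \<Rightarrow> real" where
  "psum_norm p x = (norm (fst x) powr p + norm (snd x) powr p) powr (1 / p)"

definition equilateral :: "('v::real_vector \<Rightarrow> real) \<Rightarrow> 'v set \<Rightarrow> bool" where
  "equilateral N S \<longleftrightarrow> (\<exists>c. \<forall>x\<in>S. \<forall>y\<in>S. x \<noteq> y \<longrightarrow> N (x - y) = c)"

text \<open>
  The library's \<open>card\<close> is \<open>0\<close> on infinite sets; here infinite sets get cardinality \<open>\<infinity>\<close>.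
\<close>

definition ecard :: "'v set \<Rightarrow> enat" where
  "ecard S = (if finite S then enat (card S) else \<infinity>)"

text \<open>
  The maximum cardinality of an equilateral set for the norm \<open>N\<close>, with value \<open>\<infinity>\<close> if
  these cardinalities are unbounded. A finite supremum in \<open>enat\<close> is attained.
\<close>

definition equilateral_number :: "('v::real_vector \<Rightarrow> real) \<Rightarrow> enat" where
  "equilateral_number N = (SUP S\<in>{S. equilateral N S}. ecard S)"

end

theory Submission imports Defs begin

text \<open>
  Write \<open>p = 2 k\<close>. If an equilateral set \<open>T\<close> had more points \<open>(x\<^sub>s, y\<^sub>s)\<close> than the bound, there would be
  weights \<open>c\<close>, not all zero, annihilating every monomial of degree at most \<open>k\<close> in the first component
  and every such monomial in the second. Expanding
  \<open>\<parallel>x\<^sub>s - x\<^sub>t\<parallel>\<^sup>p = (\<parallel>x\<^sub>s\<parallel>\<^sup>2 - 2 x\<^sub>s \<bullet> x\<^sub>t + \<parallel>x\<^sub>t\<parallel>\<^sup>2)\<^sup>k\<close>, each term has degree at most \<open>k\<close> in \<open>x\<^sub>s\<close> or in \<open>x\<^sub>t\<close>,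
  so the quadratic form \<open>\<Sum>\<^sub>s \<Sum>\<^sub>t c\<^sub>s c\<^sub>t (\<parallel>x\<^sub>s - x\<^sub>t\<parallel>\<^sup>p + \<parallel>y\<^sub>s - y\<^sub>t\<parallel>\<^sup>p)\<close> vanishes. But the matrix of this form
  is a nonzero constant \<open>d\<close> off the diagonal and zero on it, and \<open>\<Sum>\<^sub>s c\<^sub>s = 0\<close>, so the form equals
  \<open>- d \<Sum>\<^sub>s c\<^sub>s\<^sup>2 \<noteq> 0\<close>.
\<close>

section \<open>Homogeneous linear systems with more unknowns than equations\<close>

lemma exists_nonzero_annihilator:
  fixes g :: "'i \<Rightarrow> 's \<Rightarrow> 'f::field"
  assumes "finite I" "finite T" "card I < card T"
  shows "\<exists>c. (\<exists>s\<in>T. c s \<noteq> 0) \<and> (\<forall>i\<in>I. (\<Sum>s\<in>T. c s * g i s) = 0)"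
  using assms
proof (induction I arbitrary: T g rule: finite_induct)
  case empty
  then have "T \<noteq> {}" by auto
  then show ?case by (intro exI[of _ "\<lambda>_. 1"]) auto
next
  case (insert i I)
  show ?case
  proof (cases "\<forall>s\<in>T. g i s = 0")
    case True
    have "card I < card T" using insert by simp
    from insert.IH[OF insert.prems(1) this, of g] True show ?thesis by auto
  next
    case False
    then obtain t where t: "t \<in> T" "g i t \<noteq> 0" by blast
    \<comment> \<open>Row \<open>j\<close> minus the multiple of the pivot row that clears column
      \<open>t\<close>.\<close>
    define h where "h j s = g j s - g j t * g i s / g i t" for j s
    have "card I < card (T - {t})" "finite (T - {t})"
      using insert t by auto
    from insert.IH[OF this(2,1), of h] obtain c where
      c: "\<exists>s\<in>T - {t}. c s \<noteq> 0" "\<And>j. j \<in> I \<Longrightarrow> (\<Sum>s\<in>T - {t}. c s * h j s) = 0"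
      by blast
    \<comment> \<open>The value at \<open>t\<close> that equation \<open>i\<close> forces.\<close>
    define q where "q = - (\<Sum>s\<in>T - {t}. c s * g i s) / g i t"
    define e where "e = c(t := q)"
    have split: "(\<Sum>s\<in>T. e s * g j s) = q * g j t + (\<Sum>s\<in>T - {t}. c s * g j s)" for j
      by (subst sum.remove[OF insert.prems(1) t(1)]) (simp add: e_def)
    have "(\<Sum>s\<in>T. e s * g i s) = 0"
      unfolding split q_def using t by simp
    moreover have "(\<Sum>s\<in>T. e s * g j s) = 0" if "j \<in> I" for j
    proof -
      have "(\<Sum>s\<in>T - {t}. c s * h j s)
          = (\<Sum>s\<in>T - {t}. c s * g j s) - g j t / g i t * (\<Sum>s\<in>T - {t}. c s * g i s)"
        by (simp add: h_def right_diff_distrib sum_subtractf sum_distrib_left mult_ac)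
      then show ?thesis
        unfolding split q_def using c(2)[OF that] t by simp
    qed
    moreover have "\<exists>s\<in>T. e s \<noteq> 0" using c(1) by (auto simp: e_def)
    ultimately show ?thesis by blast
  qed
qed

section \<open>Monomials and the number of exponents of bounded degree\<close>

definition monomial :: "('n::finite \<Rightarrow> nat) \<Rightarrow> real ^ 'n \<Rightarrow> real" where
  "monomial \<alpha> x = (\<Prod>i\<in>UNIV. (x $ i) ^ \<alpha> i)"

definition exponents :: "nat \<Rightarrow> ('n::finite \<Rightarrow> nat) set" where
  "exponents k = {\<alpha>. sum \<alpha> UNIV \<le> k}"

lemma monomial_zero [simp]: "monomial (\<lambda>_. 0) x = 1"
  by (simp add: monomial_def)

lemma monomial_Suc: "monomial (\<alpha>(i := Suc (\<alpha> i))) x = monomial \<alpha> x * x $ i"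
proof -
  have "(\<Prod>j\<in>UNIV - {i}. (x $ j) ^ (\<alpha>(i := Suc (\<alpha> i))) j) = (\<Prod>j\<in>UNIV - {i}. (x $ j) ^ \<alpha> j)"
    by (intro prod.cong) auto
  then show ?thesis
    by (simp add: monomial_def prod.remove[of UNIV i])
qed

lemma sum_exponent_Suc: "sum (\<alpha>(i := Suc (\<alpha> i))) UNIV = Suc (sum \<alpha> (UNIV :: 'n::finite set))"
proof -
  have "sum (\<alpha>(i := Suc (\<alpha> i))) (UNIV - {i}) = sum \<alpha> (UNIV - {i})"
    by (intro sum.cong) auto
  then show ?thesis
    by (simp add: sum.remove[of UNIV i])
qed

text \<open>
  The slack \<open>k - sum \<alpha> UNIV\<close> is one more summand, which reduces the count to compositions of \<open>k\<close> into
  \<open>CARD('n) + 1\<close> parts.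
\<close>

lemma exponents_finite_card:
  "finite (exponents k :: ('n::finite \<Rightarrow> nat) set)"
  "card (exponents k :: ('n \<Rightarrow> nat) set) = (CARD('n) + k) choose CARD('n)"
proof -
  let ?n = "CARD('n)"
  obtain e :: "nat \<Rightarrow> 'n" where e: "bij_betw e {0..<?n} UNIV"
    using ex_bij_betw_nat_finite[of "UNIV :: 'n set"] by auto
  define L where "L = {l :: nat list. length l = Suc ?n \<and> sum_list l = k}"
  define F where "F \<alpha> = (k - sum \<alpha> UNIV) # map (\<lambda>i. \<alpha> (e i)) [0..<?n]" for \<alpha> :: "'n \<Rightarrow> nat"
  have tot: "(\<Sum>i\<leftarrow>[0..<?n]. \<alpha> (e i)) = sum \<alpha> UNIV" for \<alpha> :: "'n \<Rightarrow> nat"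
    using sum.reindex_bij_betw[OF e, of \<alpha>] by (simp add: interv_sum_list_conv_sum_set_nat)
  have "bij_betw F (exponents k) L"
    unfolding bij_betw_def
  proof (intro conjI subset_antisym subsetI)
    show "inj_on F (exponents k)"
    proof (rule inj_onI, rule ext)
      fix \<alpha> \<beta> :: "'n \<Rightarrow> nat" and j
      assume "F \<alpha> = F \<beta>"
      then have "\<forall>i<?n. \<alpha> (e i) = \<beta> (e i)"
        by (auto simp: F_def)
      moreover obtain i where "i < ?n" "e i = j"
        using e unfolding bij_betw_def by (metis UNIV_I atLeastLessThan_iff imageE)
      ultimately show "\<alpha> j = \<beta> j" by auto
    qed
  next
    fix l assume "l \<in> F ` exponents k"
    then show "l \<in> L"
      by (auto simp: F_def L_def exponents_def tot)
  next
    fix l assume "l \<in> L"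
    then obtain m l' where l: "l = m # l'" "length l' = ?n" "m + sum_list l' = k"
      by (cases l) (auto simp: L_def)
    define \<alpha> where "\<alpha> j = l' ! inv_into {0..<?n} e j" for j
    have ae: "\<alpha> (e i) = l' ! i" if "i < ?n" for i
      using that bij_betw_inv_into_left[OF e, of i] by (simp add: \<alpha>_def)
    have map: "map (\<lambda>i. \<alpha> (e i)) [0..<?n] = l'"
      by (rule nth_equalityI) (use l ae in auto)
    then have "sum \<alpha> UNIV = sum_list l'"
      using tot[of \<alpha>] by simp
    then have "F \<alpha> = l" "\<alpha> \<in> exponents k"
      using map l by (auto simp: F_def exponents_def)
    then show "l \<in> F ` exponents k" by blast
  qed
  moreover have card: "card L = (?n + k) choose ?n"
    using card_length_sum_list[of "Suc ?n" k] binomial_symmetric[of k "?n + k"]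
    by (simp add: L_def add.commute)
  \<comment> \<open>The binomial coefficient is positive, and \<open>card\<close> would be 0 on an
    infinite set.\<close>
  moreover have "finite L"
    by (rule card_ge_0_finite) (simp add: card)
  ultimately show "finite (exponents k :: ('n \<Rightarrow> nat) set)"
    "card (exponents k :: ('n \<Rightarrow> nat) set) = (?n + k) choose ?n"
    by (auto dest: bij_betw_same_card bij_betw_finite)
qed

section \<open>Vanishing moments and the quadratic form of the distances\<close>

context
  fixes T :: "'s set" and c :: "'s \<Rightarrow> real" and x :: "'s \<Rightarrow> real ^ 'n" and k :: nat
  assumes moments: "\<And>\<alpha>. \<alpha> \<in> exponents k \<Longrightarrow> (\<Sum>s\<in>T. c s * monomial \<alpha> (x s)) = 0"
begin

text \<open>Holds in particular for every polynomial \<open>f\<close> of degree at most \<open>d\<close>.\<close>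

definition annihilated :: "nat \<Rightarrow> (real ^ 'n \<Rightarrow> real) \<Rightarrow> bool" where
  "annihilated d f \<longleftrightarrow>
    (\<forall>\<alpha>. sum \<alpha> UNIV + d \<le> k \<longrightarrow> (\<Sum>s\<in>T. c s * monomial \<alpha> (x s) * f (x s)) = 0)"

lemma annihilated_one: "annihilated 0 (\<lambda>_. 1)"
  using moments by (simp add: annihilated_def exponents_def)

text \<open>The coordinate is absorbed into the test monomial, raising its degree by one; this is
  why \<open>annihilated\<close> quantifies over test monomials.\<close>

lemma annihilated_coord:
  assumes "annihilated d f"
  shows "annihilated (Suc d) (\<lambda>v. v $ i * f v)"
  unfolding annihilated_def
proof (intro allI impI)
  fix \<alpha> :: "'n \<Rightarrow> nat"
  assume "sum \<alpha> UNIV + Suc d \<le> k"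
  then have "sum (\<alpha>(i := Suc (\<alpha> i))) UNIV + d \<le> k"
    by (simp only: sum_exponent_Suc)
  with assms have "(\<Sum>s\<in>T. c s * monomial (\<alpha>(i := Suc (\<alpha> i))) (x s) * f (x s)) = 0"
    unfolding annihilated_def by blast
  then show "(\<Sum>s\<in>T. c s * monomial \<alpha> (x s) * (x s $ i * f (x s))) = 0"
    by (simp only: monomial_Suc mult_ac)
qed

lemma annihilated_sum:
  assumes "\<And>i. i \<in> A \<Longrightarrow> annihilated d (f i)"
  shows "annihilated d (\<lambda>v. \<Sum>i\<in>A. a i * f i v)"
  unfolding annihilated_def
proof (intro allI impI)
  fix \<alpha> :: "'n \<Rightarrow> nat"
  assume \<alpha>: "sum \<alpha> UNIV + d \<le> k"
  have "(\<Sum>s\<in>T. c s * monomial \<alpha> (x s) * (\<Sum>i\<in>A. a i * f i (x s)))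
      = (\<Sum>i\<in>A. a i * (\<Sum>s\<in>T. c s * monomial \<alpha> (x s) * f i (x s)))"
    by (simp add: sum_distrib_left mult_ac) (rule sum.swap)
  also have "\<dots> = 0"
    using assms \<alpha> by (simp add: annihilated_def)
  finally show "(\<Sum>s\<in>T. c s * monomial \<alpha> (x s) * (\<Sum>i\<in>A. a i * f i (x s))) = 0" .
qed

lemma annihilated_inner:
  assumes "annihilated d f"
  shows "annihilated (Suc d) (\<lambda>v. (v \<bullet> w) * f v)"
  using annihilated_sum[of UNIV "Suc d" "\<lambda>i v. v $ i * f v" "\<lambda>i. w $ i"] annihilated_coord[OF assms]
  by (simp add: inner_vec_def sum_distrib_left mult_ac)

lemma annihilated_norm_square:
  assumes "annihilated d f"
  shows "annihilated (Suc (Suc d)) (\<lambda>v. (v \<bullet> v) * f v)"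
  using annihilated_sum[of UNIV "Suc (Suc d)" "\<lambda>i v. v $ i * (v $ i * f v)" "\<lambda>_. 1"]
    annihilated_coord[OF annihilated_coord[OF assms]]
  by (simp add: inner_vec_def sum_distrib_left mult_ac)

text \<open>As a polynomial in \<open>x s\<close>, each squared norm costs degree 2 and each inner
  product with the fixed \<open>w\<close> costs degree 1. The test monomial is then taken to be
  1.\<close>

lemma sum_norm_inner_eq_0:
  assumes "2 * i + j \<le> k"
  shows "(\<Sum>s\<in>T. c s * ((x s \<bullet> x s) ^ i * (x s \<bullet> w) ^ j)) = 0"
proof -
  have "annihilated j (\<lambda>v. (v \<bullet> w) ^ j)" for j
    by (induction j) (use annihilated_one annihilated_inner in auto)
  then have "annihilated (2 * i + j) (\<lambda>v. (v \<bullet> v) ^ i * (v \<bullet> w) ^ j)"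
    by (induction i) (use annihilated_norm_square in \<open>auto simp: mult.assoc\<close>)
  then have "(\<Sum>s\<in>T. c s * monomial (\<lambda>_. 0) (x s) * ((x s \<bullet> x s) ^ i * (x s \<bullet> w) ^ j)) = 0"
    using assms unfolding annihilated_def by (elim allE[of _ "\<lambda>_. 0"]) simp
  then show ?thesis by simp
qed

text \<open>Induction on \<open>n\<close> replaces a trinomial expansion: splitting one squared
  distance into its three terms raises \<open>i\<close>, \<open>l\<close> or \<open>j\<close> by one
  and preserves the total \<open>k\<close>.\<close>

lemma double_sum_eq_0:
  assumes "n + i + j + l = k"
  shows "(\<Sum>s\<in>T. \<Sum>t\<in>T. c s * c t * ((x s \<bullet> x s) ^ i * (x t \<bullet> x t) ^ l * (x s \<bullet> x t) ^ j
    * ((x s - x t) \<bullet> (x s - x t)) ^ n)) = 0" (is "?D n i j l = 0")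
  using assms
proof (induction n arbitrary: i j l)
  case 0
  show ?case
  \<comment> \<open>The degrees \<open>2 * i + j\<close> in \<open>x s\<close> and
    \<open>2 * l + j\<close> in \<open>x t\<close> add up to at most \<open>2 * k\<close>, so the
    smaller is at most \<open>k\<close>; the sum over that variable is taken first.\<close>
  proof (cases "i \<le> l")
    case True
    then have "2 * i + j \<le> k" using 0 by simp
    have "?D 0 i j l
        = (\<Sum>t\<in>T. c t * (x t \<bullet> x t) ^ l * (\<Sum>s\<in>T. c s * ((x s \<bullet> x s) ^ i * (x s \<bullet> x t) ^ j)))"
      by (subst sum.swap) (simp add: sum_distrib_left mult_ac)
    with sum_norm_inner_eq_0[OF \<open>2 * i + j \<le> k\<close>] show ?thesis by simp
  next
    case False
    then have "2 * l + j \<le> k" using 0 by simp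
    have "?D 0 i j l
        = (\<Sum>s\<in>T. c s * (x s \<bullet> x s) ^ i * (\<Sum>t\<in>T. c t * ((x t \<bullet> x t) ^ l * (x t \<bullet> x s) ^ j)))"
      by (simp add: sum_distrib_left mult_ac inner_commute)
    with sum_norm_inner_eq_0[OF \<open>2 * l + j \<le> k\<close>] show ?thesis by simp
  qed
next
  case (Suc n)
  have "(u - v) \<bullet> (u - v) = u \<bullet> u + v \<bullet> v - 2 * (u \<bullet> v)" for u v :: "real ^ 'n"
    by (simp add: inner_diff inner_commute)
  then have "?D (Suc n) i j l = ?D n (Suc i) j l + ?D n i j (Suc l) - 2 * ?D n i (Suc j) l"
    unfolding sum_distrib_left sum.distrib[symmetric] sum_subtractf[symmetric] power_Suc
    by (intro sum.cong refl) (simp add: algebra_simps)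
  moreover have "?D n (Suc i) j l = 0" "?D n i j (Suc l) = 0" "?D n i (Suc j) l = 0"
    by (rule Suc.IH; use Suc.prems in simp)+
  ultimately show ?case by (simp only: diff_self mult_zero_right add_0)
qed

lemma double_sum_norm_power_eq_0:
  "(\<Sum>s\<in>T. \<Sum>t\<in>T. c s * c t * norm (x s - x t) ^ (2 * k)) = 0"
  using double_sum_eq_0[of k 0 0 0] by (simp add: power_mult power2_norm_eq_inner)

end

section \<open>Equilateral sets in the p-sum\<close>

lemma equilateral_subset:
  assumes "equilateral N S" and "T \<subseteq> S"
  shows "equilateral N T"
proof -
  from assms(1) obtain r where "\<forall>x\<in>S. \<forall>y\<in>S. x \<noteq> y \<longrightarrow> N (x - y) = r"
    unfolding equilateral_def by (elim exE)
  then have "\<forall>x\<in>T. \<forall>y\<in>T. x \<noteq> y \<longrightarrow> N (x - y) = r"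
    using subsetD[OF assms(2)] by simp
  then show ?thesis
    unfolding equilateral_def by (rule exI)
qed

lemma psum_norm_power:
  assumes "p > 0"
  shows "psum_norm (real p) z powr real p = norm (fst z) ^ p + norm (snd z) ^ p"
  using assms by (simp add: psum_norm_def powr_powr powr_realpow')

lemma card_equilateral_le:
  fixes T :: "((real ^ 'a) \<times> (real ^ 'b)) set"
  assumes k: "k > 0" and fin: "finite T" and eq: "equilateral (psum_norm (real (2 * k))) T"
  shows "card T \<le> ((CARD('a) + k) choose CARD('a)) + ((CARD('b) + k) choose CARD('b))"
proof (rule ccontr)
  assume "\<not> ?thesis"
  \<comment> \<open>The disjoint union keeps one equation per monomial and component, so its size is
    exactly the claimed bound.\<close>
  moreover define I where "I = (exponents k :: ('a \<Rightarrow> nat) set) <+> (exponents k :: ('b \<Rightarrow> nat) set)"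
  ultimately have "finite I" "card I < card T"
    by (auto simp: card_Plus exponents_finite_card)
  from exists_nonzero_annihilator[OF this(1) fin this(2),
      of "case_sum (\<lambda>\<alpha> s. monomial \<alpha> (fst s)) (\<lambda>\<beta> s. monomial \<beta> (snd s))"]
  obtain c where c: "\<exists>s\<in>T. c s \<noteq> 0"
    and ann: "\<And>\<gamma>. \<gamma> \<in> I \<Longrightarrow> (\<Sum>s\<in>T. c s * case_sum (\<lambda>\<alpha> s. monomial \<alpha> (fst s)) (\<lambda>\<beta> s. monomial \<beta> (snd s)) \<gamma> s) = 0"
    by blast
  have fst0: "(\<Sum>s\<in>T. c s * monomial \<alpha> (fst s)) = 0" if "\<alpha> \<in> exponents k" for \<alpha>
    using ann[of "Inl \<alpha>"] that by (auto simp: I_def)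
  have snd0: "(\<Sum>s\<in>T. c s * monomial \<beta> (snd s)) = 0" if "\<beta> \<in> exponents k" for \<beta>
    using ann[of "Inr \<beta>"] that by (auto simp: I_def)
  define D where "D s t = norm (fst s - fst t) ^ (2 * k) + norm (snd s - snd t) ^ (2 * k)"
    for s t :: "(real ^ 'a) \<times> (real ^ 'b)"
  from eq obtain r where
    "\<forall>s\<in>T. \<forall>t\<in>T. s \<noteq> t \<longrightarrow> psum_norm (real (2 * k)) (s - t) = r"
    unfolding equilateral_def by (elim exE)
  then have r: "psum_norm (real (2 * k)) (s - t) = r" if "s \<in> T" "t \<in> T" "s \<noteq> t" for s t
    using that by simp
  define d where "d = r powr real (2 * k)"
  have D: "D s t = (if s = t then 0 else d)" if "s \<in> T" "t \<in> T" for s t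
  proof (cases "s = t")
    case True
    then show ?thesis using k by (simp add: D_def)
  next
    case False
    have "D s t = psum_norm (real (2 * k)) (s - t) powr real (2 * k)"
      by (subst psum_norm_power) (use k in \<open>simp_all add: D_def\<close>)
    then show ?thesis
      unfolding r[OF that False] d_def using False by simp
  qed
  have sum0: "(\<Sum>s\<in>T. c s) = 0"
    using fst0[of "\<lambda>_. 0"] by (simp add: exponents_def)
  \<comment> \<open>On a single point \<open>r\<close> would be arbitrary. Since the weights sum to
    0 and one is nonzero, \<open>T\<close> has a second point, so \<open>d\<close> is the value of
    \<open>D\<close> at two distinct points.\<close>
  have "d \<noteq> 0"
  proof -
    obtain s where s: "s \<in> T" "c s \<noteq> 0" using c by blast
    have "\<exists>t\<in>T. t \<noteq> s"
    proof (rule ccontr)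
      assume "\<not> ?thesis"
      with s have "T = {s}" by blast
      with sum0 s show False by simp
    qed
    then obtain t where t: "t \<in> T" "t \<noteq> s" by blast
    then have "D s t \<noteq> 0"
      by (auto simp: D_def add_nonneg_eq_0_iff prod_eq_iff)
    with D[OF s(1) t(1)] t show ?thesis by auto
  qed
  have "0 = (\<Sum>s\<in>T. \<Sum>t\<in>T. c s * c t * D s t)"
    using double_sum_norm_power_eq_0[OF fst0] double_sum_norm_power_eq_0[OF snd0]
    by (simp add: D_def distrib_left sum.distrib)
  \<comment> \<open>A constant matrix minus its diagonal; the constant part factors into a product
    of two zero sums.\<close>
  also have "\<dots> = (\<Sum>s\<in>T. \<Sum>t\<in>T. d * (c s * c t) - (if s = t then d * (c s * c t) else 0))"
    by (intro sum.cong refl) (simp add: D)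
  also have "\<dots> = d * ((\<Sum>s\<in>T. c s) * (\<Sum>t\<in>T. c t)) - d * (\<Sum>s\<in>T. (c s)\<^sup>2)"
    using fin by (simp add: sum_subtractf power2_eq_square flip: sum_distrib_left sum_distrib_right)
  also have "\<dots> = - d * (\<Sum>s\<in>T. (c s)\<^sup>2)"
    by (simp add: sum0)
  finally have "(\<Sum>s\<in>T. (c s)\<^sup>2) = 0"
    using \<open>d \<noteq> 0\<close> by simp
  with fin c show False
    by (simp add: sum_nonneg_eq_0_iff)
qed

text \<open>An infinite set would contain a finite subset with \<open>n + 1\<close> points. This
  reduces the bound to finite sets, where the weighted sums make sense.\<close>

lemma ecard_le_if_finite_subsets:
  assumes "\<And>T. T \<subseteq> S \<Longrightarrow> finite T \<Longrightarrow> card T \<le> n"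
  shows "ecard S \<le> enat n"
proof (cases "finite S")
  case True
  with assms show ?thesis by (simp add: ecard_def)
next
  case False
  then obtain T where "T \<subseteq> S" "finite T" "card T = Suc n"
    using infinite_arbitrarily_large by blast
  with assms[of T] show ?thesis by simp
qed

theorem theorem5:
  fixes p :: nat
  assumes "p > 0" and "even p"
  shows "equilateral_number (psum_norm (real p) :: (real ^ 'a) \<times> (real ^ 'b) \<Rightarrow> real)
    \<le> enat (((CARD('a) + p div 2) choose CARD('a)) + ((CARD('b) + p div 2) choose CARD('b)))"
  unfolding equilateral_number_def
proof (rule SUP_least, rule ecard_le_if_finite_subsets)
  fix S T :: "((real ^ 'a) \<times> (real ^ 'b)) set"
  assume "S \<in> {S. equilateral (psum_norm (real p)) S}" and T: "T \<subseteq> S" "finite T"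
  then have "equilateral (psum_norm (real p)) T"
    by (blast intro: equilateral_subset)
  moreover have "2 * (p div 2) = p" "p div 2 > 0"
    using assms by (auto elim: evenE)
  ultimately show "card T
      \<le> ((CARD('a) + p div 2) choose CARD('a)) + ((CARD('b) + p div 2) choose CARD('b))"
    using T card_equilateral_le[of "p div 2" T] by simp
qed

end
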